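(* Let $n\ge 3$ and let $L_1,\dots,L_n$ be closed segments in the Cartesian plane, parallel to the $y$-axis, where $L_i$ has endpoints $A_i(x_i,a_i)$ and $B_i(x_i,b_i)$, with $a_i\le b_i$ for every $i\in\{1,\dots,n\}$ and $x_1<x_2<\cdots<x_n$. Fix indices $1\le s<t\le n$ such that the slope of the line $A_sB_t$ is the minimum of the slopes of all lines $A_iB_j$ with $1\le i<j\le n$, and fix indices $1\le u<v\le n$ such that the slope of the line $B_uA_v$ is the maximum of the slopes of all lines $B_iA_j$ with $1\le i<j\le n$. Then the following are equivalent: (i) there exists at least one line that intersects all the segments $L_1,\dots,L_n$; (ii) $\Phi(A_i,B_j,A_k)\le 0\le\Phi(B_i,A_j,B_k)$ for all $i,j,k$ with $1\le i<j<k\le n$; (iii) the line $A_sB_t$ intersects all the segments $L_1,\dots,L_n$; (iv) the line $B_uA_v$ intersects all the segments $L_1,\dots,L_n$.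
   Context: For three points $A(x_A,y_A)$, $B(x_B,y_B)$, $C(x_C,y_C)$ of $\mathbb{R}^2$, the operator $\Phi:(\mathbb{R}^2)^3\to\mathbb{R}$ is defined by $$\Phi(A,B,C):=\det\begin{pmatrix} 1 & 1 & 1 \\ x_A & x_B & x_C \\ y_A & y_B & y_C \end{pmatrix}.$$ Segments are allowed to degenerate to a point ($a_i=b_i$). A line intersects a closed segment if they have at least one common point (endpoints included). *)

theory Defs
  imports "HOL-Analysis.Analysis"
begin

definition Phi :: "real^2 \<Rightarrow> real^2 \<Rightarrow> real^2 \<Rightarrow> real" where
  "Phi A B C = det (vector [vector [1, 1, 1],
                            vector [A $ 1, B $ 1, C $ 1],
                            vector [A $ 2, B $ 2, C $ 2]] :: real^3^3)"

(* Lines are point sets; vertical lines are included. *)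
definition is_line :: "(real^2) set \<Rightarrow> bool" where
  "is_line l \<longleftrightarrow> affine l \<and> aff_dim l = 1"

(* A line only when P and Q are distinct. *)
definition line_through :: "real^2 \<Rightarrow> real^2 \<Rightarrow> (real^2) set" where
  "line_through P Q = affine hull {P, Q}"

(* Slope of the line PQ; meaningful only when P and Q have different abscissae. *)
definition slope :: "real^2 \<Rightarrow> real^2 \<Rightarrow> real" where
  "slope P Q = (Q $ 2 - P $ 2) / (Q $ 1 - P $ 1)"

definition intersects :: "(real^2) set \<Rightarrow> (real^2) set \<Rightarrow> bool" where
  "intersects l S \<longleftrightarrow> l \<inter> S \<noteq> {}"

end

theory Submission
  imports Defs
begin

text \<open>
  A non-vertical line of slope \<open>m\<close> and intercept \<open>c\<close> meets every segment iff
  \<open>a i - m * x i \<le> c \<le> b i - m * x i\<close> for all \<open>i\<close>.  Shearing the plane along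
  the \<open>y\<close>-axis by \<open>m\<close> makes the line horizontal, and \<open>\<Phi>\<close> does not change
  under a shear.

  The sign conditions (ii) say that the upper end of a middle segment is not below the chord
  joining the lower ends of two outer ones, and that its lower end is not above the chord
  joining their upper ends.  A common transversal separates such an end from such a chord,
  so (i) implies (ii).

  The heart is that (ii) implies (iii), lemma \<open>extremal_line_is_transversal\<close>.
  Shear so that \<open>A\<^sub>s B\<^sub>t\<close> becomes the horizontal line at height \<open>c\<close>.
  Minimality of its slope says that every upper end lies at or above every lower end to its
  left.  Hence lower ends left of \<open>t\<close> are at most the upper end \<open>c\<close> at \<open>t\<close>,
  and upper ends right of \<open>s\<close> are at least the lower end \<open>c\<close> at \<open>s\<close>.  The
  lower end at \<open>t\<close> and the upper end at \<open>s\<close> belong to segments with the other end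
  at height \<open>c\<close>.  Only lower ends right of \<open>t\<close> and upper ends left of \<open>s\<close> remain, and (ii) for the triples
  \<open>(s, t, k)\<close> and \<open>(k, s, t)\<close> bounds these by \<open>c\<close> as well.

  Condition (iv) is condition (iii) for the configuration reflected in the \<open>x\<close>-axis, which
  exchanges lower and upper ends, minimal and maximal slopes, and the two halves of (ii).
  Finally (iii) and (iv) each imply (i), because their lines are genuine lines.
\<close>

section \<open>Lines and vertical segments in coordinates\<close>

lemma Phi_eq:
  "Phi P Q R = (Q $ 1 - P $ 1) * (R $ 2 - P $ 2) - (R $ 1 - P $ 1) * (Q $ 2 - P $ 2)"
  unfolding Phi_def by (simp add: det_3 algebra_simps)

lemma vec2_eq_iff: "(P :: real^2) = Q \<longleftrightarrow> P $ 1 = Q $ 1 \<and> P $ 2 = Q $ 2"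
  by (simp add: vec_eq_iff forall_2)

lemma mem_line_through_iff:
  assumes "P $ 1 \<noteq> Q $ 1"
  shows "R \<in> line_through P Q \<longleftrightarrow> R $ 2 = P $ 2 + slope P Q * (R $ 1 - P $ 1)"
proof
  assume "R \<in> line_through P Q"
  then obtain p q where "R = p *\<^sub>R P + q *\<^sub>R Q" and "p + q = 1"
    unfolding line_through_def affine_hull_2 by blast
  then have "R = (1 - q) *\<^sub>R P + q *\<^sub>R Q"
    by (simp add: eq_diff_eq flip: \<open>p + q = 1\<close>)
  then have "R $ 1 = (1 - q) * P $ 1 + q * Q $ 1" and "R $ 2 = (1 - q) * P $ 2 + q * Q $ 2"
    by simp_all
  then have "R $ 1 - P $ 1 = q * (Q $ 1 - P $ 1)" and "R $ 2 = P $ 2 + q * (Q $ 2 - P $ 2)"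
    by (simp_all add: algebra_simps)
  then show "R $ 2 = P $ 2 + slope P Q * (R $ 1 - P $ 1)"
    using assms by (simp add: slope_def)
next
  assume R: "R $ 2 = P $ 2 + slope P Q * (R $ 1 - P $ 1)"
  define q where "q = (R $ 1 - P $ 1) / (Q $ 1 - P $ 1)"
  have "R $ 1 = P $ 1 + q * (Q $ 1 - P $ 1)"
    using assms by (simp add: q_def)
  moreover have "R $ 2 = P $ 2 + q * (Q $ 2 - P $ 2)"
    using R by (simp add: q_def slope_def)
  ultimately have "R = (1 - q) *\<^sub>R P + q *\<^sub>R Q"
    by (simp add: vec2_eq_iff algebra_simps)
  then show "R \<in> line_through P Q"
    unfolding line_through_def affine_hull_2 by (smt (verit) mem_Collect_eq)
qed

lemma mem_vertical_segment_iff: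
  fixes x a b :: real
  assumes "a \<le> b"
  shows "R \<in> closed_segment (vector [x, a]) (vector [x, b] :: real^2) \<longleftrightarrow>
         R $ 1 = x \<and> a \<le> R $ 2 \<and> R $ 2 \<le> b"
proof -
  have "R \<in> closed_segment (vector [x, a]) (vector [x, b]) \<longleftrightarrow>
        R $ 1 = x \<and> R $ 2 \<in> closed_segment a b"
    by (auto simp: in_segment vec2_eq_iff algebra_simps)
  then show ?thesis
    using assms by (simp add: closed_segment_eq_real_ivl)
qed

lemma line_through_intersects_iff:
  fixes x a b :: real
  assumes "P $ 1 \<noteq> Q $ 1" and "a \<le> b"
  shows "intersects (line_through P Q) (closed_segment (vector [x, a]) (vector [x, b])) \<longleftrightarrow>
         a \<le> P $ 2 + slope P Q * (x - P $ 1) \<and> P $ 2 + slope P Q * (x - P $ 1) \<le> b"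
    (is "_ \<longleftrightarrow> a \<le> ?y \<and> ?y \<le> b")
proof -
  have "intersects (line_through P Q) (closed_segment (vector [x, a]) (vector [x, b])) \<longleftrightarrow>
        (\<exists>R :: real^2. R $ 2 = P $ 2 + slope P Q * (R $ 1 - P $ 1) \<and> R $ 1 = x \<and> a \<le> R $ 2 \<and> R $ 2 \<le> b)"
    by (auto simp: intersects_def mem_line_through_iff[OF assms(1)]
        mem_vertical_segment_iff[OF assms(2)])
  also have "\<dots> \<longleftrightarrow> a \<le> ?y \<and> ?y \<le> b"
  proof
    assume "a \<le> ?y \<and> ?y \<le> b"
    then show "\<exists>R :: real^2. R $ 2 = P $ 2 + slope P Q * (R $ 1 - P $ 1) \<and> R $ 1 = x \<and> a \<le> R $ 2 \<and> R $ 2 \<le> b"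
      by (intro exI[of _ "vector [x, ?y]"]) simp
  qed auto
  finally show ?thesis .
qed

lemma is_line_line_through: "P \<noteq> Q \<Longrightarrow> is_line (line_through P Q)"
  by (simp add: is_line_def line_through_def aff_dim_affine_hull aff_dim_2)

lemma is_line_through_two_points:
  assumes "is_line l" and "P \<in> l" and "Q \<in> l" and "P \<noteq> Q"
  shows "l = line_through P Q"
proof -
  have "line_through P Q \<subseteq> l"
    using assms unfolding line_through_def is_line_def by (intro hull_minimal) auto
  moreover have "is_line (line_through P Q)"
    by (rule is_line_line_through[OF assms(4)])
  moreover have "line_through P Q \<noteq> {}"
    by (simp add: line_through_def)
  ultimately show ?thesis
    using assms(1) unfolding is_line_def by (metis affine_dim_equal)
qed

section \<open>Transversals of vertical segments\<close>

text \<open>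
  Two segments at different abscissae suffice to exclude vertical transversals: the line is
  spanned by one point of each, so it is the graph of an affine function.
\<close>

lemma transversal_graph:
  fixes x a b :: "nat \<Rightarrow> real"
  assumes l: "is_line l"
    and meets: "\<And>i. i \<in> I \<Longrightarrow> intersects l (closed_segment (vector [x i, a i]) (vector [x i, b i]))"
    and ab: "\<And>i. i \<in> I \<Longrightarrow> a i \<le> b i"
    and pq: "p \<in> I" "q \<in> I" "x p \<noteq> x q"
  obtains m c where "\<And>i. i \<in> I \<Longrightarrow> a i \<le> m * x i + c \<and> m * x i + c \<le> b i"
proof -
  have on: "\<exists>P\<in>l. P $ 1 = x i" if "i \<in> I" for i
    using meets[OF that] by (auto simp: intersects_def mem_vertical_segment_iff[OF ab[OF that]])
  obtain P Q where P: "P \<in> l" "P $ 1 = x p" and Q: "Q \<in> l" "Q $ 1 = x q"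
    using on pq by metis
  then have ne: "P $ 1 \<noteq> Q $ 1"
    using pq by simp
  then have l_eq: "l = line_through P Q"
    using is_line_through_two_points[OF l] P Q by blast
  show thesis
  proof (rule that)
    fix i assume i: "i \<in> I"
    show "a i \<le> slope P Q * x i + (P $ 2 - slope P Q * P $ 1) \<and>
          slope P Q * x i + (P $ 2 - slope P Q * P $ 1) \<le> b i"
      using meets[OF i] line_through_intersects_iff[OF ne ab[OF i], of "x i"]
      by (simp add: l_eq algebra_simps)
  qed
qed

text \<open>
  A convex combination of lower ends is at most the same combination of heights of the
  transversal; the middle height is such a combination and is at most the middle upper end.
  The weights are \<open>x\<^sub>k - x\<^sub>j\<close> and \<open>x\<^sub>j - x\<^sub>i\<close>.
\<close>

lemma chord_below_upper_end:
  fixes xi xj xk m c :: real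
  assumes "xi < xj" "xj < xk"
    and "ai \<le> m * xi + c" "m * xj + c \<le> bj" "ak \<le> m * xk + c"
  shows "(xj - xi) * (ak - ai) \<le> (xk - xi) * (bj - ai)"
proof -
  have "(xj - xi) * ak + (xk - xj) * ai \<le> (xj - xi) * (m * xk + c) + (xk - xj) * (m * xi + c)"
    using assms by (intro add_mono mult_left_mono) auto
  also have "\<dots> = (xk - xi) * (m * xj + c)"
    by (simp add: algebra_simps)
  also have "\<dots> \<le> (xk - xi) * bj"
    using assms by (intro mult_left_mono) auto
  finally show ?thesis
    by (simp add: algebra_simps)
qed

text \<open>
  The slope \<open>m\<close> is that of \<open>A\<^sub>s B\<^sub>t\<close>, minimal among all \<open>A\<^sub>i B\<^sub>j\<close>; \<open>lower\<close> and
  \<open>upper\<close> are the two halves of (ii) in coordinates.  They serve only for lower ends right of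
  \<open>t\<close> and upper ends left of \<open>s\<close>; minimality and \<open>a i \<le> b i\<close> handle all other ends.
\<close>

lemma extremal_line_is_transversal:
  fixes x a b :: "nat \<Rightarrow> real"
  assumes ab: "\<And>i. i \<in> {1..n} \<Longrightarrow> a i \<le> b i"
    and x: "\<And>i j. 1 \<le> i \<Longrightarrow> i < j \<Longrightarrow> j \<le> n \<Longrightarrow> x i < x j"
    and st: "1 \<le> s" "s < t" "t \<le> n"
    and touch: "b t - a s = m * (x t - x s)"
    and minimal: "\<And>i j. 1 \<le> i \<Longrightarrow> i < j \<Longrightarrow> j \<le> n \<Longrightarrow> m * (x j - x i) \<le> b j - a i"
    and lower: "\<And>i j k. 1 \<le> i \<Longrightarrow> i < j \<Longrightarrow> j < k \<Longrightarrow> k \<le> n \<Longrightarrow>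
                  (x j - x i) * (a k - a i) \<le> (x k - x i) * (b j - a i)"
    and upper: "\<And>i j k. 1 \<le> i \<Longrightarrow> i < j \<Longrightarrow> j < k \<Longrightarrow> k \<le> n \<Longrightarrow>
                  (x k - x i) * (a j - b i) \<le> (x j - x i) * (b k - b i)"
    and k: "k \<in> {1..n}"
  shows "a k \<le> a s + m * (x k - x s) \<and> a s + m * (x k - x s) \<le> b k"
proof
  have pos: "0 < x t - x s"
    using x[of s t] st by simp
  have b_t: "b t = a s + m * (x t - x s)"
    using touch by simp
  show "a k \<le> a s + m * (x k - x s)"
  proof (cases k t rule: linorder_cases)
    case less
    then show ?thesis
      using minimal[of k t] k st b_t by (simp add: algebra_simps)
  next
    case equal
    then show ?thesis
      using ab[of t] k b_t by simp
  next
    case greater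
    then have "(x t - x s) * (a k - a s) \<le> (x k - x s) * (b t - a s)"
      using lower[of s t k] k st by simp
    also have "\<dots> = (x t - x s) * (m * (x k - x s))"
      by (simp add: touch)
    finally show ?thesis
      using pos by simp
  qed
  show "a s + m * (x k - x s) \<le> b k"
  proof (cases k s rule: linorder_cases)
    case less
    then have "(x t - x k) * (a s - b k) \<le> (x s - x k) * (b t - b k)"
      using upper[of k s t] k st by simp
    \<comment> \<open>Subtracting \<open>(x s - x k) * (a s - b k)\<close> leaves the positive factor \<open>x t - x s\<close> on both sides.\<close>
    then have "(x t - x s) * (a s - b k) \<le> (x t - x s) * (m * (x s - x k))"
      by (simp add: b_t algebra_simps)
    then have "a s - b k \<le> m * (x s - x k)"
      using pos by simp
    then show ?thesis
      by (simp add: algebra_simps)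
  next
    case equal
    then show ?thesis
      using ab[of s] k by simp
  next
    case greater
    then show ?thesis
      using minimal[of s k] k st by (simp add: algebra_simps)
  qed
qed

section \<open>The equivalence\<close>

theorem mainTheorem1:
  fixes n s t u v :: nat
    and x a b :: "nat \<Rightarrow> real"
    and A B :: "nat \<Rightarrow> real^2"
    and L :: "nat \<Rightarrow> (real^2) set"
  assumes "n \<ge> 3"
    and "\<And>i. i \<in> {1..n} \<Longrightarrow> A i = vector [x i, a i]"
    and "\<And>i. i \<in> {1..n} \<Longrightarrow> B i = vector [x i, b i]"
    and "\<And>i. i \<in> {1..n} \<Longrightarrow> L i = closed_segment (A i) (B i)"
    and "\<And>i. i \<in> {1..n} \<Longrightarrow> a i \<le> b i"
    and "\<And>i j. 1 \<le> i \<Longrightarrow> i < j \<Longrightarrow> j \<le> n \<Longrightarrow> x i < x j"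
    and "1 \<le> s" "s < t" "t \<le> n"
    and "\<And>i j. 1 \<le> i \<Longrightarrow> i < j \<Longrightarrow> j \<le> n \<Longrightarrow> slope (A s) (B t) \<le> slope (A i) (B j)"
    and "1 \<le> u" "u < v" "v \<le> n"
    and "\<And>i j. 1 \<le> i \<Longrightarrow> i < j \<Longrightarrow> j \<le> n \<Longrightarrow> slope (B i) (A j) \<le> slope (B u) (A v)"
  defines "cond_i \<equiv> (\<exists>l. is_line l \<and> (\<forall>i\<in>{1..n}. intersects l (L i)))"
    and "cond_ii \<equiv> (\<forall>i j k. 1 \<le> i \<and> i < j \<and> j < k \<and> k \<le> n \<longrightarrow>
           Phi (A i) (B j) (A k) \<le> 0 \<and> 0 \<le> Phi (B i) (A j) (B k))"
    and "cond_iii \<equiv> (\<forall>i\<in>{1..n}. intersects (line_through (A s) (B t)) (L i))"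
    and "cond_iv \<equiv> (\<forall>i\<in>{1..n}. intersects (line_through (B u) (A v)) (L i))"
  shows "(cond_i \<longleftrightarrow> cond_ii) \<and> (cond_ii \<longleftrightarrow> cond_iii) \<and> (cond_iii \<longleftrightarrow> cond_iv)"
proof -
  note A = assms(2) and B = assms(3) and L = assms(4) and ab = assms(5) and x = assms(6)
  have seg: "L i = closed_segment (vector [x i, a i]) (vector [x i, b i])" if "i \<in> {1..n}" for i
    using A B L that by simp
  have slope_AB: "slope (A i) (B j) * (x j - x i) = b j - a i"
    and slope_BA: "slope (B i) (A j) * (x j - x i) = a j - b i"
    if "1 \<le> i" "i < j" "j \<le> n" for i j
    using A[of i] A[of j] B[of i] B[of j] x[of i j] that by (simp_all add: slope_def)
  have Phi_ABA: "Phi (A i) (B j) (A k) \<le> 0 \<longleftrightarrow>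
                 (x j - x i) * (a k - a i) \<le> (x k - x i) * (b j - a i)"
    and Phi_BAB: "0 \<le> Phi (B i) (A j) (B k) \<longleftrightarrow>
                  (x k - x i) * (a j - b i) \<le> (x j - x i) * (b k - b i)"
    if "1 \<le> i" "i < j" "j < k" "k \<le> n" for i j k
    using A B that by (simp_all add: Phi_eq)
  have st: "1 \<le> s" "s < t" "t \<le> n" and uv: "1 \<le> u" "u < v" "v \<le> n"
    using assms(7-9,11-13) by auto
  have ne_st: "A s $ 1 \<noteq> B t $ 1" and ne_uv: "B u $ 1 \<noteq> A v $ 1"
    using A[of s] B[of t] A[of v] B[of u] x[of s t] x[of u v] st uv by simp_all

  have i_ii: cond_ii if i: cond_i
  proof -
    obtain l where l: "is_line l" and meets: "\<And>i. i \<in> {1..n} \<Longrightarrow> intersects l (L i)"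
      using i unfolding cond_i_def by blast
    have "intersects l (closed_segment (vector [x i, a i]) (vector [x i, b i]))"
      if "i \<in> {1..n}" for i
      using meets[OF that] seg[OF that] by simp
    moreover have "s \<in> {1..n}" "t \<in> {1..n}" "x s \<noteq> x t"
      using st x[of s t] by auto
    ultimately obtain m c where mc: "\<And>i. i \<in> {1..n} \<Longrightarrow> a i \<le> m * x i + c \<and> m * x i + c \<le> b i"
      using transversal_graph[where I = "{1..n}" and x = x and a = a and b = b, OF l _ ab] by blast
    have "Phi (A i) (B j) (A k) \<le> 0 \<and> 0 \<le> Phi (B i) (A j) (B k)"
      if ijk: "1 \<le> i" "i < j" "j < k" "k \<le> n" for i j k
    proof
      have xs: "x i < x j" "x j < x k"
        using x ijk by simp_all
      have ends: "a i \<le> m * x i + c" "m * x i + c \<le> b i" "a j \<le> m * x j + c"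
          "m * x j + c \<le> b j" "a k \<le> m * x k + c" "m * x k + c \<le> b k"
        using mc[of i] mc[of j] mc[of k] ijk by simp_all
      show "Phi (A i) (B j) (A k) \<le> 0"
        unfolding Phi_ABA[OF ijk] using chord_below_upper_end[OF xs] ends by blast
      \<comment> \<open>The other half is the same inequality for the configuration reflected in the \<open>x\<close>-axis.\<close>
      have "(x j - x i) * (- b k - - b i) \<le> (x k - x i) * (- a j - - b i)"
        using ends by (intro chord_below_upper_end[OF xs, where m = "- m" and c = "- c"]) simp_all
      then show "0 \<le> Phi (B i) (A j) (B k)"
        unfolding Phi_BAB[OF ijk] by (simp add: algebra_simps)
    qed
    then show ?thesis
      unfolding cond_ii_def by blast
  qed

  have lower: "(x j - x i) * (a k - a i) \<le> (x k - x i) * (b j - a i)"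
    and upper: "(x k - x i) * (a j - b i) \<le> (x j - x i) * (b k - b i)"
    if cond_ii "1 \<le> i" "i < j" "j < k" "k \<le> n" for i j k
    using that Phi_ABA[OF that(2-)] Phi_BAB[OF that(2-)] unfolding cond_ii_def by blast+

  have ii_iii: cond_iii if cond_ii
    unfolding cond_iii_def
  proof
    fix k assume k: "k \<in> {1..n}"
    have "slope (A s) (B t) * (x j - x i) \<le> b j - a i" if "1 \<le> i" "i < j" "j \<le> n" for i j
      using mult_right_mono[OF assms(10)[OF that], of "x j - x i"] slope_AB[OF that] x[OF that]
      by simp
    then have "a k \<le> a s + slope (A s) (B t) * (x k - x s) \<and>
               a s + slope (A s) (B t) * (x k - x s) \<le> b k"
      using slope_AB[OF st] lower[OF that] upper[OF that]
      by (intro extremal_line_is_transversal[where b = b, OF ab x st _ _ _ _ k]) simp_all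
    then show "intersects (line_through (A s) (B t)) (L k)"
      unfolding seg[OF k] line_through_intersects_iff[OF ne_st ab[OF k]] using A[of s] st by simp
  qed

  have ii_iv: cond_iv if cond_ii
    unfolding cond_iv_def
  proof
    fix k assume k: "k \<in> {1..n}"
    have maximal: "a j - b i \<le> slope (B u) (A v) * (x j - x i)"
      if "1 \<le> i" "i < j" "j \<le> n" for i j
      using mult_right_mono[OF assms(14)[OF that], of "x j - x i"] slope_BA[OF that] x[OF that]
      by simp
    \<comment> \<open>Reflection in the \<open>x\<close>-axis: \<open>- b\<close> are the lower and \<open>- a\<close> the upper ends.\<close>
    have "- b k \<le> - b u + - slope (B u) (A v) * (x k - x u) \<and>
          - b u + - slope (B u) (A v) * (x k - x u) \<le> - a k"
    proof (rule extremal_line_is_transversal[where a = "\<lambda>i. - b i" and b = "\<lambda>i. - a i",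
          OF _ x uv _ _ _ _ k])
      fix i j h :: nat
      show "- slope (B u) (A v) * (x j - x i) \<le> - a j - - b i" if "1 \<le> i" "i < j" "j \<le> n"
        using maximal[OF that] by simp
      assume ijh: "1 \<le> i" "i < j" "j < h" "h \<le> n"
      show "(x j - x i) * (- b h - - b i) \<le> (x h - x i) * (- a j - - b i)"
        using upper[OF \<open>cond_ii\<close> ijh] by (simp add: algebra_simps)
      show "(x h - x i) * (- b j - - a i) \<le> (x j - x i) * (- a h - - a i)"
        using lower[OF \<open>cond_ii\<close> ijh] by (simp add: algebra_simps)
    qed (use ab slope_BA[OF uv] in simp_all)
    then show "intersects (line_through (B u) (A v)) (L k)"
      unfolding seg[OF k] line_through_intersects_iff[OF ne_uv ab[OF k]] using B[of u] uv by simp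
  qed

  have "A s \<noteq> B t" "B u \<noteq> A v"
    using ne_st ne_uv by auto
  then have "cond_i" if "cond_iii \<or> cond_iv"
    using that is_line_line_through unfolding cond_i_def cond_iii_def cond_iv_def by blast
  then show ?thesis
    using i_ii ii_iii ii_iv by blast
qed

end
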